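(* Let $\bm G_p$, $\bm Q$, $\bm\Lambda_G=\operatorname{diag}(\mu_1,\ldots,\mu_p)$ and the coefficient matrix $\bm C\in\mathbb F^{p\times K}$ with rows $\bm c_1^{\mathsf T},\ldots,\bm c_p^{\mathsf T}$ be as defined in the context, let $L\in\mathbb N_0$, and for $j=1,\ldots,p$ put $$\alpha_j=\|\bm c_j^{\mathsf T}\|_2^2,\qquad P_j^{(L)}=\sum_{\ell=0}^{L}\mu_j^\ell,\qquad E_j^{(L)}=\alpha_jP_j^{(L)} .$$ Then the accumulated quadratic energy $$\mathscr J_L(\bm C)=\sum_{\ell=0}^{L}\operatorname{trace}\bigl(\bm C^{\mathrm H}\bm\Lambda_G^{\ell}\bm C\bigr)$$ admits the additive modal decomposition $$\mathscr J_L(\bm C)=\sum_{j=1}^{p}E_j^{(L)} .$$ Therefore, sorting the modes by decreasing $E_j^{(L)}$ orders the orthogonal delay-coordinate structures jointly by measured-data relevance (the factor $\alpha_j$) and finite-horizon energetic persistence (the factor $P_j^{(L)}$).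
   Context: $\mathbb F=\mathbb R$ or $\mathbb C$; $(\cdot)^{\mathrm H}$ is the conjugate transpose; $\mu^0=1$ and $\bm\Lambda_G^0=\bm I_p$. Let $\bm x_H=(x_{H,1},\ldots,x_{H,N_H})\in\mathbb F^{N_H}$ (the columnwise vectorization of a centered data matrix in $\mathbb F^{m\times N}$, $N_H=mN$), $q\in\{1,\ldots,N_H-1\}$, $K=N_H-q+1\ge2$. The Hankel matrix $\bm H\in\mathbb F^{q\times K}$ has entries $H_{ij}=x_{H,i+j-1}$ and columns $\bm h_1,\ldots,\bm h_K$; $\bm H_0=[\bm h_1\cdots\bm h_{K-1}]$, $\bm H_1=[\bm h_2\cdots\bm h_K]$. Let $p=\operatorname{rank}(\bm H_0)\ge1$ and $\bm H_0=\bm U_p\bm\Sigma_p\bm V_p^{\mathrm H}$ be the economy-size SVD restricted to the positive singular values ($\bm U_p^{\mathrm H}\bm U_p=\bm V_p^{\mathrm H}\bm V_p=\bm I_p$, $\bm\Sigma_p$ diagonal with positive diagonal). Define $\widetilde{\bm K}_p=\bm U_p^{\mathrm H}\bm H_1\bm V_p\bm\Sigma_p^{-1}\in\mathbb F^{p\times p}$ and $\bm G_p=\widetilde{\bm K}_p^{\mathrm H}\widetilde{\bm K}_p$. Let $\bm Q=[\bm q_1,\ldots,\bm q_p]\in\mathbb F^{p\times p}$ satisfy $\bm Q^{\mathrm H}\bm Q=\bm I_p$ and $\bm G_p\bm Q=\bm Q\bm\Lambda_G$ with $\bm\Lambda_G=\operatorname{diag}(\mu_1,\ldots,\mu_p)$,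 $\mu_1\ge\cdots\ge\mu_p\ge0$. The Hankel–Koopman energy modes are the columns of $\bm\Phi=\bm U_p\bm Q\in\mathbb F^{q\times p}$, and $\bm C=\bm\Phi^{\mathrm H}\bm H\in\mathbb F^{p\times K}$ is the coefficient matrix, whose $j$th row is $\bm c_j^{\mathsf T}$. $L$ is called the operator horizon, $\alpha_j$ the coefficient energy, $P_j^{(L)}$ the finite-horizon persistence factor, and $E_j^{(L)}$ the finite-horizon modal energy. *)

theory Defs
  imports
    "Jordan_Normal_Form.Schur_Decomposition"
    "Jordan_Normal_Form.DL_Rank"
    "HOL-Analysis.L2_Norm"
    "HOL-Combinatorics.Permutations"
begin

text \<open>
  The scalar field. By the Gelfand-Mazur theorem a real normed field is isometrically isomorphic
  to the real or the complex numbers, and the axiom below then forces \<^const>\<open>conjugate\<close>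
  to be the usual conjugation. So, up to isomorphism, the two instances given here are the only
  ones.
\<close>

class real_or_complex = conjugatable_field + real_normed_field +
  assumes mult_conjugate_eq_scaleR: "a * conjugate a = scaleR ((norm a)\<^sup>2) 1"

lemma mult_conjugate_eq_norm:
  "a * conjugate a = of_real ((norm a)\<^sup>2)" for a :: "'a :: real_or_complex"
  by (simp only: mult_conjugate_eq_scaleR of_real_def)

instance real :: real_or_complex
  by standard (simp add: power2_eq_square)

instance complex :: real_or_complex
  by standard (simp only: conjugate_complex_def complex_norm_square[symmetric] of_real_def[symmetric])

definition real_diag :: "nat \<Rightarrow> (nat \<Rightarrow> real) \<Rightarrow> 'a :: real_or_complex mat" where
  "real_diag n d = mat_diag n (\<lambda>i. of_real (d i))"

definition mat_trace :: "'a :: comm_monoid_add mat \<Rightarrow> 'a" where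
  "mat_trace A = (\<Sum>i<dim_row A. A $$ (i, i))"

definition vec_norm2 :: "'a :: real_normed_vector vec \<Rightarrow> real" where
  "vec_norm2 v = L2_set (\<lambda>i. norm (v $ i)) {..<dim_vec v}"

text \<open>
  All indices start at 0: the \<open>(i, j)\<close> entry of the Hankel matrix is \<open>x\<^sub>i\<^sub>+\<^sub>j\<close>, and
  its columns are numbered \<open>0, \<dots>, K - 1\<close>.
\<close>

definition hankel_ncols :: "nat \<Rightarrow> 'a vec \<Rightarrow> nat" where
  "hankel_ncols q x = dim_vec x - q + 1"

definition hankel :: "nat \<Rightarrow> 'a vec \<Rightarrow> 'a mat" where
  "hankel q x = mat q (hankel_ncols q x) (\<lambda>(i, j). x $ (i + j))"

definition hankel0 :: "nat \<Rightarrow> 'a vec \<Rightarrow> 'a mat" where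
  "hankel0 q x = mat_of_cols q (map (col (hankel q x)) [0..<hankel_ncols q x - 1])"

definition hankel1 :: "nat \<Rightarrow> 'a vec \<Rightarrow> 'a mat" where
  "hankel1 q x = mat_of_cols q (map (col (hankel q x)) [1..<hankel_ncols q x])"

text \<open>
  Singular value decomposition of \<open>A\<close> restricted to its positive singular values
  \<open>s 0, \<dots>, s (p - 1)\<close>. They may come in any order.
\<close>

definition positive_svd ::
  "'a :: real_or_complex mat \<Rightarrow> nat \<Rightarrow> 'a mat \<Rightarrow> (nat \<Rightarrow> real) \<Rightarrow> 'a mat \<Rightarrow> bool" where
  "positive_svd A p U s V \<longleftrightarrow>
     U \<in> carrier_mat (dim_row A) p \<and> V \<in> carrier_mat (dim_col A) p \<and>
     mat_adjoint U * U = 1\<^sub>m p \<and> mat_adjoint V * V = 1\<^sub>m p \<and>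
     (\<forall>i<p. 0 < s i) \<and>
     A = U * real_diag p s * mat_adjoint V"

definition koopman_matrix ::
  "nat \<Rightarrow> 'a :: real_or_complex vec \<Rightarrow> nat \<Rightarrow> 'a mat \<Rightarrow> (nat \<Rightarrow> real) \<Rightarrow> 'a mat \<Rightarrow> 'a mat" where
  "koopman_matrix q x p U s V =
     mat_adjoint U * hankel1 q x * V * real_diag p (\<lambda>i. inverse (s i))"

lemma real_diag_inverse:
  assumes "\<forall>i<p. 0 < s i"
  shows "inverts_mat (real_diag p s :: 'a :: real_or_complex mat)
           (real_diag p (\<lambda>i. inverse (s i)))"
    and "inverts_mat (real_diag p (\<lambda>i. inverse (s i)) :: 'a :: real_or_complex mat)
           (real_diag p s)"
  using assms
  by (simp_all add: inverts_mat_def real_diag_def) (auto intro!: eq_matI simp: mat_diag_def)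

definition gram_matrix :: "'a :: conjugatable_field mat \<Rightarrow> 'a mat" where
  "gram_matrix A = mat_adjoint A * A"

definition energy_modes :: "'a :: semiring_0 mat \<Rightarrow> 'a mat \<Rightarrow> 'a mat" where
  "energy_modes U Q = U * Q"

definition coefficient_matrix ::
  "nat \<Rightarrow> 'a :: conjugatable_field vec \<Rightarrow> 'a mat \<Rightarrow> 'a mat" where
  "coefficient_matrix q x \<Phi> = mat_adjoint \<Phi> * hankel q x"

definition coefficient_energy :: "'a :: real_normed_vector mat \<Rightarrow> nat \<Rightarrow> real" where
  "coefficient_energy C j = (vec_norm2 (row C j))\<^sup>2"

definition persistence_factor :: "(nat \<Rightarrow> real) \<Rightarrow> nat \<Rightarrow> nat \<Rightarrow> real" where
  "persistence_factor \<mu> L j = (\<Sum>l=0..L. \<mu> j ^ l)"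

definition modal_energy ::
  "'a :: real_normed_vector mat \<Rightarrow> (nat \<Rightarrow> real) \<Rightarrow> nat \<Rightarrow> nat \<Rightarrow> real" where
  "modal_energy C \<mu> L j = coefficient_energy C j * persistence_factor \<mu> L j"

definition accumulated_energy ::
  "'a :: conjugatable_field mat \<Rightarrow> nat \<Rightarrow> 'a mat \<Rightarrow> 'a" where
  "accumulated_energy \<Lambda> L C = (\<Sum>l=0..L. mat_trace (mat_adjoint C * (\<Lambda> ^\<^sub>m l) * C))"

text \<open>
  \<open>\<sigma> k\<close> is the mode placed at position \<open>k\<close>.
\<close>

definition sorts_decreasingly :: "nat \<Rightarrow> (nat \<Rightarrow> real) \<Rightarrow> (nat \<Rightarrow> nat) \<Rightarrow> bool" where
  "sorts_decreasingly p E \<sigma> \<longleftrightarrow>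
     \<sigma> permutes {..<p} \<and> (\<forall>a<p. \<forall>b<p. a \<le> b \<longrightarrow> E (\<sigma> b) \<le> E (\<sigma> a))"

end

theory Submission
  imports Defs
begin

text \<open>
  Since \<open>\<Lambda>\<^sub>G\<close> is diagonal, the trace splits into a sum over the rows of \<open>C\<close>. For the ordering, a larger
  energy has to follow from larger factors, one of them strictly, so no mode may have
  zero coefficient energy: restricted to the columns of \<open>H\<^sub>0\<close>, \<open>C\<close> equals \<open>Q\<^sup>H \<Sigma> V\<^sup>H\<close>, which has
  a right inverse.
\<close>

lemma mat_adjoint_carrier [simp]:
  "A \<in> carrier_mat m n \<Longrightarrow> mat_adjoint A \<in> carrier_mat n m"
  by (auto simp: mat_adjoint_def)

lemma index_mat_adjoint:
  assumes "A \<in> carrier_mat m n" "i < n" "j < m"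
  shows "mat_adjoint A $$ (i, j) = conjugate (A $$ (j, i))"
  using assms by (auto simp: mat_adjoint_def mat_of_rows_def)

text \<open>In contrast to \<open>assoc_mult_mat\<close>, usable as a rewrite rule: no dimension is left to guess.\<close>

lemma mult_mat_assoc_dims:
  fixes A B C :: "'a :: semiring_0 mat"
  assumes "dim_col A = dim_row B" "dim_col B = dim_row C"
  shows "A * B * C = A * (B * C)"
  using assms by (intro assoc_mult_mat[of A "dim_row A" "dim_row B" B "dim_row C"]) auto

lemma mat_adjoint_mult:
  fixes A B :: "'a :: conjugatable_field mat"
  assumes A: "A \<in> carrier_mat m n" and B: "B \<in> carrier_mat n k"
  shows "mat_adjoint (A * B) = mat_adjoint B * mat_adjoint A"
proof (rule eq_matI)
  have AB: "A * B \<in> carrier_mat m k" using A B by simp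
  note a = mat_adjoint_carrier[OF A] and b = mat_adjoint_carrier[OF B]
  show "dim_row (mat_adjoint (A * B)) = dim_row (mat_adjoint B * mat_adjoint A)"
    "dim_col (mat_adjoint (A * B)) = dim_col (mat_adjoint B * mat_adjoint A)"
    using mat_adjoint_carrier[OF AB] a b by auto
  fix i j assume "i < dim_row (mat_adjoint B * mat_adjoint A)"
    "j < dim_col (mat_adjoint B * mat_adjoint A)"
  hence ij: "i < k" "j < m" using a b by auto
  show "mat_adjoint (A * B) $$ (i, j) = (mat_adjoint B * mat_adjoint A) $$ (i, j)"
    using A B carrier_matD[OF a] carrier_matD[OF b] ij
    by (simp add: index_mat_adjoint[OF AB] index_mat_adjoint[OF A] index_mat_adjoint[OF B]
        scalar_prod_def) (simp add: sum_conjugate conjugate_dist_mul mult.commute)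
qed

lemma real_diag_carrier [simp]: "real_diag n d \<in> carrier_mat n n"
  by (simp add: real_diag_def)

lemma real_diag_mult: "real_diag n d * real_diag n e = real_diag n (\<lambda>i. d i * e i)"
  by (simp add: real_diag_def)

lemma real_diag_pow: "real_diag n d ^\<^sub>m l = real_diag n (\<lambda>i. d i ^ l)"
proof (induction l)
  case 0
  \<comment> \<open>In HOL \<open>0 ^ 0 = 1\<close>, so the zeroth power is the identity even when
    some diagonal entries vanish; this matches the convention for \<mu> and the diagonal
    matrix.\<close>
  show ?case by (auto simp: real_diag_def mat_diag_def)
next
  case (Suc l)
  thus ?case by (simp add: real_diag_mult mult.commute)
qed

lemma coefficient_energy_eq:
  assumes "C \<in> carrier_mat p k" "j < p"
  shows "coefficient_energy C j = (\<Sum>i<k. (norm (C $$ (j, i)))\<^sup>2)"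
  using assms by (auto simp: coefficient_energy_def vec_norm2_def L2_set_def
      intro!: sum.cong real_sqrt_pow2 sum_nonneg)

text \<open>The diagonal entry at \<open>i\<close> is a sum over \<open>j\<close> of
  \<open>d j\<close> times the squared modulus of \<open>C $$ (j, i)\<close>. Exchanging the two
  sums collects these moduli along rows, and each row contributes its squared norm.\<close>

lemma trace_adjoint_real_diag:
  fixes C :: "'a :: real_or_complex mat"
  assumes C: "C \<in> carrier_mat p k"
  shows "mat_trace (mat_adjoint C * real_diag p d * C)
    = of_real (\<Sum>j<p. d j * coefficient_energy C j)"
proof -
  note a = mat_adjoint_carrier[OF C]
  have "(mat_adjoint C * real_diag p d * C) $$ (i, i)
      = (\<Sum>j<p. of_real (d j * (norm (C $$ (j, i)))\<^sup>2))" if i: "i < k" for i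
  proof -
    have "mat_adjoint C * real_diag p d = mat k p (\<lambda>(i, j). mat_adjoint C $$ (i, j) * of_real (d j))"
      unfolding real_diag_def by (rule mat_diag_mult_right[OF a])
    hence "(mat_adjoint C * real_diag p d * C) $$ (i, i)
        = (\<Sum>j<p. mat_adjoint C $$ (i, j) * of_real (d j) * C $$ (j, i))"
      using C i by (auto simp: scalar_prod_def lessThan_atLeast0)
    \<comment> \<open>The factors are reordered so that an entry meets its own conjugate, the form
      covered by \<open>mult_conjugate_eq_norm\<close>.\<close>
    also have "\<dots> = (\<Sum>j<p. of_real (d j) * (C $$ (j, i) * conjugate (C $$ (j, i))))"
      using i by (intro sum.cong) (auto simp: index_mat_adjoint[OF C])
    finally show ?thesis by (simp add: mult_conjugate_eq_norm)
  qed
  moreover have "dim_row (mat_adjoint C * real_diag p d * C) = k" using a by simp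
  ultimately have "mat_trace (mat_adjoint C * real_diag p d * C)
      = (\<Sum>i<k. \<Sum>j<p. of_real (d j * (norm (C $$ (j, i)))\<^sup>2))"
    by (simp add: mat_trace_def)
  also have "\<dots> = (\<Sum>j<p. \<Sum>i<k. of_real (d j * (norm (C $$ (j, i)))\<^sup>2))"
    by (rule sum.swap)
  also have "\<dots> = of_real (\<Sum>j<p. d j * coefficient_energy C j)"
    by (simp add: coefficient_energy_eq[OF C] sum_distrib_left)
  finally show ?thesis .
qed

text \<open>Each power of the diagonal matrix is again real diagonal, so the trace formula applies
  for every \<open>l\<close>. After exchanging the sums over \<open>l\<close> and \<open>j\<close>,
  the coefficient energy factors out and leaves the geometric sum.\<close>

lemma accumulated_energy_real_diag:
  fixes C :: "'a :: real_or_complex mat"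
  assumes C: "C \<in> carrier_mat p k"
  shows "accumulated_energy (real_diag p \<mu>) L C = of_real (\<Sum>j<p. modal_energy C \<mu> L j)"
proof -
  have "accumulated_energy (real_diag p \<mu>) L C
      = of_real (\<Sum>l=0..L. \<Sum>j<p. \<mu> j ^ l * coefficient_energy C j)"
    by (simp add: accumulated_energy_def real_diag_pow trace_adjoint_real_diag[OF C])
  also have "(\<Sum>l=0..L. \<Sum>j<p. \<mu> j ^ l * coefficient_energy C j)
      = (\<Sum>j<p. \<Sum>l=0..L. \<mu> j ^ l * coefficient_energy C j)"
    by (rule sum.swap)
  also have "\<dots> = (\<Sum>j<p. modal_energy C \<mu> L j)"
    by (simp add: modal_energy_def persistence_factor_def sum_distrib_left mult.commute)
  finally show ?thesis .
qed

lemma hankel_carrier: "hankel q x \<in> carrier_mat q (hankel_ncols q x)"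
  by (simp add: hankel_def)

lemma hankel0_carrier: "hankel0 q x \<in> carrier_mat q (hankel_ncols q x - 1)"
  by (rule carrier_matI) (simp_all add: hankel0_def)

lemma col_hankel0:
  "k < hankel_ncols q x - 1 \<Longrightarrow> col (hankel0 q x) k = col (hankel q x) k"
  by (simp add: hankel0_def hankel_def)

text \<open>If row \<open>j\<close> of \<open>C\<close> vanished, so would row \<open>j\<close> of
  \<open>mat_adjoint (U * Q) * hankel0 q x\<close>. A matrix with a right inverse has no zero
  row.\<close>

lemma coefficient_energy_pos:
  fixes x :: "'a :: real_or_complex vec"
  assumes svd: "positive_svd (hankel0 q x) p U s V"
    and Q: "Q \<in> carrier_mat p p" "mat_adjoint Q * Q = 1\<^sub>m p"
    and j: "j < p"
  defines "C \<equiv> coefficient_matrix q x (energy_modes U Q)"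
  shows "0 < coefficient_energy C j"
proof (rule ccontr)
  assume nonpos: "\<not> 0 < coefficient_energy C j"
  let ?K = "hankel_ncols q x"
  let ?S = "real_diag p s :: 'a mat" and ?T = "real_diag p (\<lambda>i. inverse (s i)) :: 'a mat"
  let ?H = "hankel0 q x" and ?P = "mat_adjoint (U * Q)"
  from svd have U: "U \<in> carrier_mat q p" and V: "V \<in> carrier_mat (?K - 1) p"
    and UU: "mat_adjoint U * U = 1\<^sub>m p" and VV: "mat_adjoint V * V = 1\<^sub>m p"
    and s: "\<forall>i<p. 0 < s i" and H: "?H = U * ?S * mat_adjoint V"
    using hankel0_carrier[of q x] by (auto simp: positive_svd_def)
  note Ua = mat_adjoint_carrier[OF U] and Va = mat_adjoint_carrier[OF V]
    and Qa = mat_adjoint_carrier[OF Q(1)]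
  have UQ: "U * Q \<in> carrier_mat q p" using U Q by simp
  note P = mat_adjoint_carrier[OF UQ]
  have ST: "?S * ?T = 1\<^sub>m p"
    using real_diag_inverse(1)[OF s, where ?'a = 'a] by (simp add: inverts_mat_def carrier_matD(1)[OF real_diag_carrier])
  have C: "C \<in> carrier_mat p ?K"
    using P hankel_carrier[of q x] by (simp add: C_def coefficient_matrix_def energy_modes_def)
  have "(\<Sum>i<?K. (norm (C $$ (j, i)))\<^sup>2) = 0"
    using nonpos sum_nonneg[of "{..<?K}" "\<lambda>i. (norm (C $$ (j, i)))\<^sup>2"]
    by (simp add: coefficient_energy_eq[OF C j])
  hence zero: "C $$ (j, i) = 0" if "i < ?K" for i
    using that by (simp add: sum_nonneg_eq_0_iff)
  \<comment> \<open>\<open>hankel0\<close> consists of all columns of \<open>hankel\<close> but the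
    last, so its product with \<open>?P\<close> is \<open>C\<close> without its last column.\<close>
  have row0: "row (?P * ?H) j = 0\<^sub>v (?K - 1)"
  proof (rule eq_vecI)
    fix i assume "i < dim_vec (0\<^sub>v (?K - 1) :: 'a vec)"
    hence i: "i < ?K - 1" by simp
    have "row (?P * ?H) j $ i = C $$ (j, i)"
      using i j P hankel0_carrier[of q x] hankel_carrier[of q x]
      by (simp add: C_def coefficient_matrix_def energy_modes_def col_hankel0)
    thus "row (?P * ?H) j $ i = 0\<^sub>v (?K - 1) $ i" using zero i by simp
  qed (use hankel0_carrier[of q x] in auto)
  have S: "?S \<in> carrier_mat p p" and T: "?T \<in> carrier_mat p p" by simp_all
  \<comment> \<open>The right inverse undoes the factors of \<open>Q\<close>^H \<Sigma>
    \<open>V\<close>^H in reverse order. Reassociation makes the adjoint pairs of \<open>U\<close>,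
    \<open>V\<close> and \<open>Q\<close> adjacent, as well as \<open>?S\<close> and
    \<open>?T\<close>, and each pair collapses to the identity.\<close>
  have inv: "?P * ?H * (V * ?T * Q) = 1\<^sub>m p"
  proof -
    have "?P * ?H * (V * ?T * Q)
        = mat_adjoint Q * ((mat_adjoint U * U) * ?S * (mat_adjoint V * V) * ?T) * Q"
      unfolding H mat_adjoint_mult[OF U Q(1)]
      using carrier_matD[OF U] carrier_matD[OF V] carrier_matD[OF Ua] carrier_matD[OF Va]
        carrier_matD[OF Qa] carrier_matD[OF Q(1)] carrier_matD[OF S] carrier_matD[OF T]
      by (simp add: mult_mat_assoc_dims)
    thus ?thesis using Q Qa UU VV ST S by simp
  qed
  have "V * ?T * Q \<in> carrier_mat (?K - 1) p"
    using V Q(1) T by (intro mult_carrier_mat)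
  hence "col (V * ?T * Q) j \<in> carrier_vec (?K - 1)" by (rule col_carrier_vec[OF j])
  hence "row (?P * ?H) j \<bullet> col (V * ?T * Q) j = 0" by (simp only: row0 scalar_prod_left_zero)
  \<comment> \<open>The same diagonal entry is 1 by \<open>inv\<close> and 0 by the vanishing
    row.\<close>
  moreover have "(?P * ?H * (V * ?T * Q)) $$ (j, j) = row (?P * ?H) j \<bullet> col (V * ?T * Q) j"
    using j carrier_matD[OF P] carrier_matD[OF Q(1)] by simp
  ultimately show False using j unfolding inv by simp
qed

text \<open>Ensures that a claim about all decreasing orderings is not vacuous. Sorting by the
  negated key gives the decreasing order.\<close>

lemma sorts_decreasingly_exists: "\<exists>\<sigma>. sorts_decreasingly p E \<sigma>"
proof -
  define xs where "xs = sort_key (\<lambda>i. - E i) [0..<p]"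
  \<comment> \<open>\<open>permutes\<close> demands fixed points outside the index range, hence the
    identity branch.\<close>
  define \<sigma> where "\<sigma> = (\<lambda>i. if i < p then xs ! i else i)"
  have xs: "length xs = p" "distinct xs" "set xs = {..<p}"
    by (auto simp: xs_def)
  have "bij_betw ((!) xs) {..<p} {..<p}" using bij_betw_nth[OF xs(2)] xs by auto
  hence "bij_betw \<sigma> {..<p} {..<p}"
    by (subst bij_betw_cong[of _ _ "(!) xs"]) (auto simp: \<sigma>_def)
  hence "\<sigma> permutes {..<p}" by (rule bij_imp_permutes) (simp add: \<sigma>_def)
  moreover have "sorted (map (\<lambda>i. - E i) xs)" by (simp add: xs_def)
  hence "E (\<sigma> b) \<le> E (\<sigma> a)" if "b < p" "a \<le> b" for a b
    using sorted_nth_mono[of "map (\<lambda>i. - E i) xs" a b] that xs by (simp add: \<sigma>_def)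
  ultimately show ?thesis unfolding sorts_decreasingly_def by blast
qed

text \<open>The term for exponent 0 equals 1 and the others are nonnegative.\<close>

lemma persistence_factor_pos:
  assumes "0 \<le> \<mu> j"
  shows "0 < persistence_factor \<mu> L j"
proof -
  have "\<mu> j ^ 0 \<le> persistence_factor \<mu> L j"
    unfolding persistence_factor_def using assms by (intro member_le_sum) auto
  thus ?thesis by simp
qed

theorem theorem1:
  fixes x :: "'a :: real_or_complex vec"
    and U V Q \<Phi> C :: "'a mat"
    and s \<mu> :: "nat \<Rightarrow> real"
    and q p L :: nat
  assumes "q \<in> {1..dim_vec x - 1}"
    and "p = vec_space.rank q (hankel0 q x)" and "1 \<le> p"
    and "positive_svd (hankel0 q x) p U s V"
    and "Q \<in> carrier_mat p p" and "mat_adjoint Q * Q = 1\<^sub>m p"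
    and "gram_matrix (koopman_matrix q x p U s V) * Q = Q * real_diag p \<mu>"
    and "\<forall>i<p. \<forall>j<p. i \<le> j \<longrightarrow> \<mu> j \<le> \<mu> i" and "\<forall>j<p. 0 \<le> \<mu> j"
    and "\<Phi> = energy_modes U Q"
    and "C = coefficient_matrix q x \<Phi>"
  shows "accumulated_energy (real_diag p \<mu>) L C = of_real (\<Sum>j<p. modal_energy C \<mu> L j)
    \<and> mat_adjoint \<Phi> * \<Phi> = 1\<^sub>m p
    \<and> (\<exists>\<sigma>. sorts_decreasingly p (modal_energy C \<mu> L) \<sigma>)
    \<and> (\<forall>\<sigma>. sorts_decreasingly p (modal_energy C \<mu> L) \<sigma> \<longrightarrow>
         (\<forall>a<p. \<forall>b<p.
            coefficient_energy C (\<sigma> b) \<le> coefficient_energy C (\<sigma> a) \<and>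
            persistence_factor \<mu> L (\<sigma> b) \<le> persistence_factor \<mu> L (\<sigma> a) \<and>
            (coefficient_energy C (\<sigma> b) < coefficient_energy C (\<sigma> a) \<or>
             persistence_factor \<mu> L (\<sigma> b) < persistence_factor \<mu> L (\<sigma> a))
            \<longrightarrow> a < b))"
proof (intro conjI allI impI)
  from assms(4) have U: "U \<in> carrier_mat q p" and UU: "mat_adjoint U * U = 1\<^sub>m p"
    using hankel0_carrier[of q x] by (auto simp: positive_svd_def)
  note Ua = mat_adjoint_carrier[OF U] and Qa = mat_adjoint_carrier[OF assms(5)]
  have \<Phi>: "\<Phi> \<in> carrier_mat q p" using U assms(5,10) by (simp add: energy_modes_def)
  have "C \<in> carrier_mat p (hankel_ncols q x)"
    using mat_adjoint_carrier[OF \<Phi>] hankel_carrier[of q x] assms(11)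
    by (simp add: coefficient_matrix_def)
  thus "accumulated_energy (real_diag p \<mu>) L C = of_real (\<Sum>j<p. modal_energy C \<mu> L j)"
    by (rule accumulated_energy_real_diag)
  \<comment> \<open>Orthogonality of the modes: \<open>U\<close> has orthonormal columns, and
    \<open>Q\<close> preserves this.\<close>
  have "mat_adjoint \<Phi> * \<Phi> = mat_adjoint Q * (mat_adjoint U * U) * Q"
    unfolding assms(10) energy_modes_def mat_adjoint_mult[OF U assms(5)]
    using carrier_matD[OF U] carrier_matD[OF Ua] carrier_matD[OF Qa] carrier_matD[OF assms(5)]
    by (simp add: mult_mat_assoc_dims)
  thus "mat_adjoint \<Phi> * \<Phi> = 1\<^sub>m p" using UU Qa assms(6) by simp
  show "\<exists>\<sigma>. sorts_decreasingly p (modal_energy C \<mu> L) \<sigma>"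
    by (rule sorts_decreasingly_exists)
  fix \<sigma> a b
  let ?\<alpha> = "coefficient_energy C" and ?P = "persistence_factor \<mu> L"
  assume sorted: "sorts_decreasingly p (modal_energy C \<mu> L) \<sigma>" and ab: "a < p" "b < p"
    and le: "?\<alpha> (\<sigma> b) \<le> ?\<alpha> (\<sigma> a) \<and> ?P (\<sigma> b) \<le> ?P (\<sigma> a) \<and>
      (?\<alpha> (\<sigma> b) < ?\<alpha> (\<sigma> a) \<or> ?P (\<sigma> b) < ?P (\<sigma> a))"
  have "\<sigma> permutes {..<p}" using sorted by (simp add: sorts_decreasingly_def)
  hence \<sigma>: "\<sigma> b < p" using ab permutes_in_image[of \<sigma> "{..<p}" b] by auto
  \<comment> \<open>If one factor of both modes were 0, a strict gain in the other would leave the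
    energies equal. Positivity at the dominated mode \<open>\<sigma> b\<close> excludes this, so the
    product is strictly monotone.\<close>
  have pos: "0 < ?\<alpha> (\<sigma> b)" "0 < ?P (\<sigma> b)"
    using coefficient_energy_pos[OF assms(4-6) \<sigma>] persistence_factor_pos assms(9-11) \<sigma> by auto
  have "modal_energy C \<mu> L (\<sigma> b) < modal_energy C \<mu> L (\<sigma> a)"
    unfolding modal_energy_def using le pos
    by (auto intro: mult_less_le_imp_less mult_le_less_imp_less)
  \<comment> \<open>If \<open>b\<close> \<le> \<open>a\<close>, sortedness would give the reverse
    inequality between the two energies.\<close>
  thus "a < b" using sorted ab by (force simp: sorts_decreasingly_def not_less[symmetric])
qed

end
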